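(* Let $A,B,C_1,\dots,C_m\in\mathbb{C}^{n\times n}$, $r_i,s_i\in\mathbb{C}^n$, $g_i\in\mathbb{C}^n\setminus\{0\}$ ($i=1,\dots,m$), and for $\lambda\in\mathbb{C}$, $\boldsymbol{\mu}=(\mu_1,\dots,\mu_m)\in\mathbb{C}^m$ let $$T_1(\lambda,\boldsymbol{\mu})=A+\lambda B+\sum_{i=1}^m\mu_iC_i,\qquad T_{j+1}(\lambda,\boldsymbol{\mu})=A+g_jr_j^T+\lambda B+\sum_{i=1}^m\mu_iC_i-\mu_jg_js_j^T\quad(j=1,\dots,m).$$ Suppose residual inverse iteration, with fixed shifts $(\sigma,\boldsymbol{\tau})\in\mathbb{C}\times\mathbb{C}^m$, is applied to the multiparameter eigenvalue problem $T_i(\lambda,\boldsymbol{\mu})x_i=0$, $i=1,\dots,m+1$, with equal normalization vectors $v_1=\cdots=v_{m+1}=v$. If $x_1^{(k)}=\cdots=x_{m+1}^{(k)}=x^{(k)}$ and $v^TT_1(\sigma,\boldsymbol{\tau})^{-1}g_i\neq0$ for $i=1,\dots,m$, then $x_1^{(k+1)}=\cdots=x_{m+1}^{(k+1)}=x^{(k+1)}$, for $k=0,1,2,\dots$.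
   Context: Residual inverse iteration for this problem is the following quasi-Newton method. The matrices $T_i(\sigma,\boldsymbol{\tau})$, $i=1,\dots,m+1$, are fixed and nonsingular. Given iterates $x_i^{(k)}\in\mathbb{C}^n$ that are normalized, $v_i^Tx_i^{(k)}=1$ for $i=1,\dots,m+1$, and $(\lambda^{(k)},\boldsymbol{\mu}^{(k)})$, one solves for $\Delta x_1,\dots,\Delta x_{m+1}\in\mathbb{C}^n$, $\Delta\lambda,\Delta\mu_1,\dots,\Delta\mu_m\in\mathbb{C}$ the linear system $$T_i(\sigma,\boldsymbol{\tau})\Delta x_i+\Delta\lambda\frac{\partial T_i}{\partial\lambda}x_i^{(k)}+\sum_{p=1}^m\Delta\mu_p\frac{\partial T_i}{\partial\mu_p}x_i^{(k)}=-T_i(\lambda^{(k)},\boldsymbol{\mu}^{(k)})x_i^{(k)},\qquad v_i^T\Delta x_i=-(v_i^Tx_i^{(k)}-1),$$ for $i=1,\dots,m+1$, and sets $x_i^{(k+1)}=x_i^{(k)}+\Delta x_i$, $\lambda^{(k+1)}=\lambda^{(k)}+\Delta\lambda$, $\mu_p^{(k+1)}=\mu_p^{(k)}+\Delta\mu_p$. (The partial derivatives of $T_i$ are constant matrices. Each step is assumed to be well defined, i.e. the linear system is solvable.) The superscript $T$ on vectors denotes transpose without conjugation. *)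

theory Defs
  imports "HOL-Analysis.Analysis"
begin

text \<open>The inner product of the library on \<^typ>\<open>complex^'n\<close> is real-valued, and its
  matrices have no scaling by complex numbers; the algebraic operations of the
  problem, none of which conjugates, are spelled out here.\<close>

definition tdot :: "complex^'n \<Rightarrow> complex^'n \<Rightarrow> complex" where
  "tdot u w = (\<Sum>a\<in>UNIV. u $ a * w $ a)"

definition outer :: "complex^'n \<Rightarrow> complex^'n \<Rightarrow> complex^'n^'n" where
  "outer u w = (\<chi> a b. u $ a * w $ b)"

definition mscale :: "complex \<Rightarrow> complex^'n^'n \<Rightarrow> complex^'n^'n" where
  "mscale c M = (\<chi> a b. c * M $ a $ b)"

text \<open>Partial derivatives of a matrix-valued function \<open>T(\<lambda>, \<mu>)\<close> are taken entrywise, as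
  complex derivatives.\<close>

definition partial_lam ::
    "(complex \<Rightarrow> complex^'m \<Rightarrow> complex^'n^'n) \<Rightarrow> complex \<Rightarrow> complex^'m \<Rightarrow> complex^'n^'n" where
  "partial_lam T lam \<mu> = (\<chi> a b. deriv (\<lambda>z. T z \<mu> $ a $ b) lam)"

definition partial_mu ::
    "'m \<Rightarrow> (complex \<Rightarrow> complex^'m \<Rightarrow> complex^'n^'n) \<Rightarrow> complex \<Rightarrow> complex^'m \<Rightarrow> complex^'n^'n" where
  "partial_mu p T lam \<mu> =
     (\<chi> a b. deriv (\<lambda>z. T lam (\<chi> q. if q = p then z else \<mu> $ q) $ a $ b) (\<mu> $ p))"

text \<open>The \<open>m + 1\<close> equations of a multiparameter eigenvalue problem with parameters
  \<open>\<lambda>, \<mu>\<^sub>1, \<dots>, \<mu>\<^sub>m\<close> are indexed by \<^typ>\<open>'m option\<close>, where \<open>CARD('m) = m\<close>: \<^const>\<open>None\<close> is the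
  first index and \<open>Some j\<close> is the index \<open>j + 1\<close>.

  A step is a relation between consecutive iterates: some solution
  of the linear system gives the update. Only solvability of that system is required,
  not uniqueness of the solution.\<close>

definition residual_inverse_step ::
    "('m option \<Rightarrow> complex \<Rightarrow> complex^'m \<Rightarrow> complex^'n^'n) \<Rightarrow> ('m option \<Rightarrow> complex^'n) \<Rightarrow>
     complex \<Rightarrow> complex^'m \<Rightarrow>
     ('m option \<Rightarrow> complex^'n) \<Rightarrow> complex \<Rightarrow> complex^'m \<Rightarrow>
     ('m option \<Rightarrow> complex^'n) \<Rightarrow> complex \<Rightarrow> complex^'m \<Rightarrow> bool" where
  "residual_inverse_step T v \<sigma> \<tau> x lam \<mu> x' lam' \<mu>' \<longleftrightarrow>
     (\<exists>dx dlam dmu.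
        (\<forall>i. T i \<sigma> \<tau> *v dx i
               + dlam *s (partial_lam (T i) lam \<mu> *v x i)
               + (\<Sum>p\<in>UNIV. (dmu $ p) *s (partial_mu p (T i) lam \<mu> *v x i))
               = - (T i lam \<mu> *v x i)
             \<and> tdot (v i) (dx i) = - (tdot (v i) (x i) - 1)) \<and>
        (\<forall>i. x' i = x i + dx i) \<and>
        lam' = lam + dlam \<and>
        \<mu>' = \<mu> + dmu)"

definition residual_inverse_iteration ::
    "('m option \<Rightarrow> complex \<Rightarrow> complex^'m \<Rightarrow> complex^'n^'n) \<Rightarrow> ('m option \<Rightarrow> complex^'n) \<Rightarrow>
     complex \<Rightarrow> complex^'m \<Rightarrow>
     (nat \<Rightarrow> 'm option \<Rightarrow> complex^'n) \<Rightarrow> (nat \<Rightarrow> complex) \<Rightarrow> (nat \<Rightarrow> complex^'m) \<Rightarrow> bool" where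
  "residual_inverse_iteration T v \<sigma> \<tau> x lam \<mu> \<longleftrightarrow>
     (\<forall>i. invertible (T i \<sigma> \<tau>)) \<and>
     (\<forall>k. (\<forall>i. tdot (v i) (x k i) = 1) \<and>
          residual_inverse_step T v \<sigma> \<tau>
            (x k) (lam k) (\<mu> k) (x (Suc k)) (lam (Suc k)) (\<mu> (Suc k)))"

definition mep_matrix ::
    "complex^'n^'n \<Rightarrow> complex^'n^'n \<Rightarrow> ('m \<Rightarrow> complex^'n^'n) \<Rightarrow>
     ('m \<Rightarrow> complex^'n) \<Rightarrow> ('m \<Rightarrow> complex^'n) \<Rightarrow> ('m \<Rightarrow> complex^'n) \<Rightarrow>
     'm option \<Rightarrow> complex \<Rightarrow> complex^'m \<Rightarrow> complex^'n^'n" where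
  "mep_matrix A B C g r s i lam \<mu> =
     (case i of
        None \<Rightarrow> A + mscale lam B + (\<Sum>p\<in>UNIV. mscale (\<mu> $ p) (C p))
      | Some j \<Rightarrow> A + outer (g j) (r j) + mscale lam B + (\<Sum>p\<in>UNIV. mscale (\<mu> $ p) (C p))
                  - mscale (\<mu> $ j) (outer (g j) (s j)))"

end

theory Submission
  imports Defs
begin

text \<open>At all parameter values, \<open>T\<^sub>j\<^sub>+\<^sub>1\<close> differs from \<open>T\<^sub>1\<close> by an outer product with left factor \<open>g\<^sub>j\<close>
  (lemma \<open>mep_matrix_Some\<close>). Hence the coefficient matrix \<open>T\<^sub>j\<^sub>+\<^sub>1(\<sigma>, \<tau>)\<close>, the
  derivatives and the residual of equation \<open>j + 1\<close> each differ from those of the first equation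
  by a matrix with range in the span of \<open>g\<^sub>j\<close>. When all current vectors are equal, subtracting the
  two block equations of one step cancels everything else and leaves
  \<open>T\<^sub>1(\<sigma>, \<tau>) (\<Delta>x\<^sub>j\<^sub>+\<^sub>1 - \<Delta>x\<^sub>1) = c g\<^sub>j\<close> for some scalar \<open>c\<close>, that is,
  \<open>\<Delta>x\<^sub>j\<^sub>+\<^sub>1 - \<Delta>x\<^sub>1 = c T\<^sub>1(\<sigma>, \<tau>)\<^sup>-\<^sup>1 g\<^sub>j\<close>. Since both normalization equations involve the same \<open>v\<close>
  and the same current vector, \<open>v\<^sup>T\<close> annihilates this difference. As
  \<open>v\<^sup>T T\<^sub>1(\<sigma>, \<tau>)\<^sup>-\<^sup>1 g\<^sub>j \<noteq> 0\<close>, this forces \<open>c = 0\<close> (lemma \<open>solve_in_span_and_kernel_eq_0\<close>), so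
  all increments agree.\<close>

lemma tdot_diff_right: "tdot u (w - z) = tdot u w - tdot u z"
  by (simp add: tdot_def right_diff_distrib sum_subtractf)

lemma tdot_scale_right: "tdot u (c *s w) = c * tdot u w"
  by (simp add: tdot_def sum_distrib_left algebra_simps)

lemma outer_mult_vec: "outer u w *v x = tdot w x *s u"
  by (simp add: vec_eq_iff outer_def tdot_def matrix_vector_mult_def sum_distrib_left
      algebra_simps)

text \<open>Both perturbations \<open>g\<^sub>j r\<^sub>j\<^sup>T\<close> and \<open>-\<mu>\<^sub>j g\<^sub>j s\<^sub>j\<^sup>T\<close> have the left factor \<open>g\<^sub>j\<close>, so they merge
  into a single outer product.\<close>

lemma mep_matrix_Some:
  "mep_matrix A B C g r s (Some j) lam \<mu>
     = mep_matrix A B C g r s None lam \<mu> + outer (g j) (r j - \<mu> $ j *s s j)"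
  by (simp add: mep_matrix_def vec_eq_iff outer_def mscale_def algebra_simps)

lemma partial_lam_mep_matrix: "partial_lam (mep_matrix A B C g r s i) lam \<mu> = B"
proof -
  have "((\<lambda>z. c + z * B $ a $ b + d - e) has_field_derivative B $ a $ b) (at lam)" for a b c d e
    by (auto intro!: derivative_eq_intros)
  \<comment> \<open>The entries have this form with \<open>e = 0\<close> for the first index.\<close>
  from this[where e = 0] this have
    "deriv (\<lambda>z. mep_matrix A B C g r s i z \<mu> $ a $ b) lam = B $ a $ b" for a b
    by (cases i) (simp_all add: mep_matrix_def mscale_def DERIV_imp_deriv)
  then show ?thesis
    by (simp add: partial_lam_def vec_eq_iff)
qed

text \<open>Differentiating with respect to one coordinate of \<open>\<mu>\<close> means differentiating through the
  updated vector, whose \<open>q\<close>-th entry is a conditional; the next two facts do this for one term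
  and for the sum over all coordinates, where only the term \<open>q = p\<close> contributes.\<close>

lemma DERIV_coordinate_update:
  "((\<lambda>z. (if q = p then z else w) * c) has_field_derivative (if q = p then c else 0)) (at y)"
  by (cases "q = p") (auto intro!: derivative_eq_intros)

lemma DERIV_sum_coordinate_update:
  fixes D :: "'m::finite \<Rightarrow> complex"
  shows "((\<lambda>z. c + (\<Sum>q\<in>UNIV. (if q = p then z else w q) * D q)) has_field_derivative D p) (at y)"
proof -
  have "((\<lambda>z. c + (\<Sum>q\<in>UNIV. (if q = p then z else w q) * D q))
      has_field_derivative 0 + (\<Sum>q\<in>UNIV. if q = p then D q else 0)) (at y)"
    by (intro DERIV_add DERIV_const DERIV_sum DERIV_coordinate_update)
  then show ?thesis by simp
qed

lemma partial_mu_mep_matrix_None: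
  fixes C :: "'m::finite \<Rightarrow> complex^'n^'n"
  shows "partial_mu p (mep_matrix A B C g r s None) lam \<mu> = C p"
proof -
  have "deriv (\<lambda>z. mep_matrix A B C g r s None lam (\<chi> q. if q = p then z else \<mu> $ q) $ a $ b) (\<mu> $ p)
      = C p $ a $ b" for a b
    unfolding mep_matrix_def mscale_def
    by (simp, rule DERIV_imp_deriv, rule DERIV_sum_coordinate_update)
  then show ?thesis
    by (simp add: partial_mu_def vec_eq_iff)
qed

lemma partial_mu_mep_matrix_Some:
  fixes C :: "'m::finite \<Rightarrow> complex^'n^'n"
  shows "partial_mu p (mep_matrix A B C g r s (Some j)) lam \<mu>
    = C p - (if p = j then outer (g j) (s j) else 0)"
proof -
  have "deriv (\<lambda>z. mep_matrix A B C g r s (Some j) lam (\<chi> q. if q = p then z else \<mu> $ q) $ a $ b) (\<mu> $ p)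
      = C p $ a $ b - (if j = p then outer (g j) (s j) $ a $ b else 0)" for a b
    unfolding mep_matrix_def mscale_def
    \<comment> \<open>Splitting the conditional would destroy the shape that the derivative rules match.\<close>
    by (simp split del: if_split, rule DERIV_imp_deriv,
        rule DERIV_diff[OF DERIV_sum_coordinate_update DERIV_coordinate_update])
  then show ?thesis
    by (simp add: partial_mu_def vec_eq_iff)
qed

text \<open>The line \<open>M\<^sup>-\<^sup>1 (span h)\<close> meets the hyperplane \<open>v\<^sup>T d = 0\<close> only in the origin, because its
  generator \<open>M\<^sup>-\<^sup>1 h\<close> lies off that hyperplane.\<close>

lemma solve_in_span_and_kernel_eq_0:
  fixes M :: "complex^'n^'n"
  assumes "invertible M" and eq: "M *v d = c *s h" and ker: "tdot v d = 0"
    and h: "tdot v (matrix_inv M *v h) \<noteq> 0"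
  shows "d = 0"
proof -
  have "matrix_inv M ** M = mat 1"
    using someI_ex[OF \<open>invertible M\<close>[unfolded invertible_def]] by (simp add: matrix_inv_def)
  then have "d = matrix_inv M *v (M *v d)"
    by (simp add: matrix_vector_mul_assoc)
  also have "\<dots> = c *s (matrix_inv M *v h)"
    by (simp add: eq vector_scalar_commute)
  finally have d: "d = c *s (matrix_inv M *v h)" .
  with ker h have "c = 0"
    by (simp add: tdot_scale_right)
  with d show ?thesis by simp
qed

text \<open>With one current vector \<open>y\<close> for all equations, the terms \<open>B y\<close>, \<open>C\<^sub>p y\<close> and \<open>T\<^sub>1(\<lambda>, \<mu>) y\<close> are
  shared by all of them and cancel in differences; only multiples of \<open>g\<^sub>j\<close> survive. The fact is
  stated for the first equation against every other one, so that \<open>x'\<close> at the first index is the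
  common next vector.\<close>

lemma residual_inverse_step_preserves_equality:
  fixes C :: "'m::finite \<Rightarrow> complex^'n^'n"
  assumes step: "residual_inverse_step (mep_matrix A B C g r s) (\<lambda>i. v) \<sigma> \<tau>
                   (\<lambda>i. y) lam \<mu> x' lam' \<mu>'"
    and inv: "invertible (mep_matrix A B C g r s None \<sigma> \<tau>)"
    and v_cond: "\<And>j. tdot v (matrix_inv (mep_matrix A B C g r s None \<sigma> \<tau>) *v g j) \<noteq> 0"
  shows "x' i = x' None"
proof (cases i)
  case (Some j)
  let ?T = "mep_matrix A B C g r s"
  from step obtain dx dlam dmu where
    eq: "\<And>i. ?T i \<sigma> \<tau> *v dx i + dlam *s (partial_lam (?T i) lam \<mu> *v y)
             + (\<Sum>p\<in>UNIV. (dmu $ p) *s (partial_mu p (?T i) lam \<mu> *v y)) = - (?T i lam \<mu> *v y)"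
    and norm: "\<And>i. tdot v (dx i) = - (tdot v y - 1)"
    and x': "\<And>i. x' i = y + dx i"
    unfolding residual_inverse_step_def by blast
  define S where "S = (\<Sum>p\<in>UNIV. (dmu $ p) *s (C p *v y))"
  have eq_None: "?T None \<sigma> \<tau> *v dx None + dlam *s (B *v y) + S = - (?T None lam \<mu> *v y)"
    using eq[of None] by (simp add: partial_lam_mep_matrix partial_mu_mep_matrix_None S_def)
  have "(dmu $ p) *s (partial_mu p (?T (Some j)) lam \<mu> *v y)
      = (dmu $ p) *s (C p *v y) - (if p = j then (dmu $ j * tdot (s j) y) *s g j else 0)" for p
    by (simp add: partial_mu_mep_matrix_Some outer_mult_vec matrix_vector_mult_diff_rdistrib)
  then have "(\<Sum>p\<in>UNIV. (dmu $ p) *s (partial_mu p (?T (Some j)) lam \<mu> *v y))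
      = S - (dmu $ j * tdot (s j) y) *s g j"
    by (simp add: S_def sum_subtractf)
  then have eq_Some: "?T None \<sigma> \<tau> *v dx (Some j) + tdot (r j - \<tau> $ j *s s j) (dx (Some j)) *s g j
        + dlam *s (B *v y) + (S - (dmu $ j * tdot (s j) y) *s g j)
      = - (?T None lam \<mu> *v y + tdot (r j - \<mu> $ j *s s j) y *s g j)"
    using eq[of "Some j"]
    by (simp add: partial_lam_mep_matrix mep_matrix_Some outer_mult_vec
        matrix_vector_mult_add_rdistrib)
  \<comment> \<open>The scalar collects the \<open>g\<^sub>j\<close>-components of derivative, residual and coefficient matrix.\<close>
  have "?T None \<sigma> \<tau> *v (dx (Some j) - dx None)
      = (dmu $ j * tdot (s j) y - tdot (r j - \<mu> $ j *s s j) y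
          - tdot (r j - \<tau> $ j *s s j) (dx (Some j))) *s g j"
    using arg_cong2[OF eq_Some eq_None, of "(-)"]
    by (simp add: algebra_simps)
  moreover have "tdot v (dx (Some j) - dx None) = 0"
    by (simp add: tdot_diff_right norm)
  ultimately have "dx (Some j) - dx None = 0"
    using solve_in_span_and_kernel_eq_0 inv v_cond by blast
  then show ?thesis
    by (simp add: Some x')
qed simp

theorem theorem4p5:
  fixes A B :: "complex^'n^'n"
    and C :: "'m::finite \<Rightarrow> complex^'n^'n"
    and g r s :: "'m \<Rightarrow> complex^'n"
    and v :: "complex^'n"
    and \<sigma> :: complex and \<tau> :: "complex^'m"
    and x :: "nat \<Rightarrow> 'm option \<Rightarrow> complex^'n"
    and lam :: "nat \<Rightarrow> complex" and \<mu> :: "nat \<Rightarrow> complex^'m"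
  assumes g_nonzero: "\<And>j. g j \<noteq> 0"
    and iteration:
      "residual_inverse_iteration (mep_matrix A B C g r s) (\<lambda>i. v) \<sigma> \<tau> x lam \<mu>"
    and v_cond:
      "\<And>j. tdot v (matrix_inv (mep_matrix A B C g r s None \<sigma> \<tau>) *v g j) \<noteq> 0"
  shows "\<forall>k. (\<exists>y. \<forall>i. x k i = y) \<longrightarrow> (\<exists>y. \<forall>i. x (Suc k) i = y)"
proof (intro allI impI)
  fix k
  let ?T = "mep_matrix A B C g r s"
  assume "\<exists>y. \<forall>i. x k i = y"
  then obtain y where y: "x k = (\<lambda>i. y)" by blast
  have step: "residual_inverse_step ?T (\<lambda>i. v) \<sigma> \<tau> (\<lambda>i. y) (lam k) (\<mu> k)
          (x (Suc k)) (lam (Suc k)) (\<mu> (Suc k))"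
    and inv: "invertible (?T None \<sigma> \<tau>)"
    using iteration by (simp_all add: residual_inverse_iteration_def flip: y)
  have "x (Suc k) i = x (Suc k) None" for i
    by (rule residual_inverse_step_preserves_equality[OF step inv v_cond])
  then show "\<exists>y. \<forall>i. x (Suc k) i = y" by blast
qed

end
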